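(* Let $T>0$. For every $t \in [0,T]$, let $f_t$ be the Fokker-Planck velocity $$f_t(x;\mu) := b_t(x) - D_t(x)\,\nabla \log p(x), \qquad x \in \mathbb{R}^d,$$ where $p$ denotes the density of the probability measure $\mu$ on $\mathbb{R}^d$, $b_t:\mathbb{R}^d\to\mathbb{R}^d$ is a velocity field, and $D_t(x)$ is a positive-semidefinite $d\times d$ matrix for each $x\in\mathbb{R}^d$. Assume that $v_t^{\theta}:\mathbb{R}^d\to\mathbb{R}^d$ and $D_t$ are bounded and continuously differentiable, and that $\mu_t^{\theta'}$ is a probability measure on $\mathbb{R}^d$ with a continuously differentiable density $p_t^{\theta'}$ that vanishes at infinity (i.e. $p_t^{\theta'}(x)\to 0$ as $\|x\|\to\infty$) and does not vanish at finite points (i.e. $p_t^{\theta'}(x)\neq 0$ for every $x\in\mathbb{R}^d$). Then $$\mathbb{E}_{X \sim \mu_t^{\theta'}}\left[ v_t^{\theta}(X)^\top f_t(X;\mu_t^{\theta'}) \right] = \mathbb{E}_{X \sim \mu_t^{\theta'}}\left[ v_t^{\theta}(X)^\top b_t(X) + \nabla\cdot\left( D_t^\top(X)\, v_t^{\theta}(X) \right) \right].$$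
   Context: Here $\nabla\cdot w = \sum_{i=1}^d \partial_{x_i} w_i$ is the divergence of a vector field $w$ on $\mathbb{R}^d$, and $\nabla\cdot(D_t^\top(X) v_t^\theta(X))$ means the divergence of the vector field $x\mapsto D_t(x)^\top v_t^\theta(x)$ evaluated at $X$. The parameters $\theta$ and $\theta'$ are two choices of weights of a neural network that parameterizes a probability flow on $\mathbb{R}^d$ over the time interval $[0,T]$: $v_t^{\theta}$ is the velocity field at time $t$ of the flow with weights $\theta$, and $\mu_t^{\theta'}$ is the probability measure at time $t$ of the flow with weights $\theta'$.
   Formalization: The formal theorem additionally assumes that both displayed expectations exist (both integrands are integrable under the measure); the listed hypotheses do not guarantee this, since the derivatives of v and D may be unbounded and b is arbitrary. *)

theory Defs
  imports "HOL-Probability.Probability"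
begin

definition continuously_differentiable ::
    "('a::real_normed_vector \<Rightarrow> 'b::real_normed_vector) \<Rightarrow> bool" where
  "continuously_differentiable f \<longleftrightarrow>
     (\<exists>f' :: 'a \<Rightarrow> 'a \<Rightarrow>\<^sub>L 'b.
        (\<forall>x. (f has_derivative blinfun_apply (f' x)) (at x)) \<and> continuous_on UNIV f')"

definition partial_deriv :: "'n \<Rightarrow> (real^'n \<Rightarrow> real) \<Rightarrow> real^'n \<Rightarrow> real" where
  "partial_deriv i g x = deriv (\<lambda>h. g (x + h *\<^sub>R axis i 1)) 0"

definition gradient :: "(real^'n \<Rightarrow> real) \<Rightarrow> real^'n \<Rightarrow> real^'n" where
  "gradient g x = (\<chi> i. partial_deriv i g x)"

definition divergence :: "(real^'n \<Rightarrow> real^'n) \<Rightarrow> real^'n \<Rightarrow> real" where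
  "divergence w x = (\<Sum>i\<in>UNIV. partial_deriv i (\<lambda>y. w y $ i) x)"

text \<open>Symmetry is deliberately not required; symmetric positive-semidefinite matrices are
  a special case.\<close>

definition positive_semidefinite :: "real^'n^'n \<Rightarrow> bool" where
  "positive_semidefinite A \<longleftrightarrow> (\<forall>x. 0 \<le> x \<bullet> (A *v x))"

text \<open>The measure \<open>\<mu>\<close> enters the velocity only through \<open>\<nabla> log p\<close>. Since a density is determined
  only up to null sets, the density \<open>p\<close> itself is the argument here; a continuous density of
  \<open>\<mu>\<close> is unique.\<close>

definition fokker_planck_velocity ::
    "(real^'n \<Rightarrow> real^'n) \<Rightarrow> (real^'n \<Rightarrow> real^'n^'n) \<Rightarrow> (real^'n \<Rightarrow> real) \<Rightarrow> real^'n \<Rightarrow> real^'n" where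
  "fokker_planck_velocity b D p x = b x - D x *v gradient (\<lambda>y. ln (p y)) x"

lemma partial_deriv_eq:
  assumes "(g has_derivative g') (at x)"
  shows "partial_deriv i g x = g' (axis i 1)"
proof -
  have 1: "((\<lambda>h::real. x + h *\<^sub>R axis i 1) has_derivative (\<lambda>h. h *\<^sub>R axis i 1)) (at 0)"
    by (auto intro!: derivative_eq_intros)
  have 2: "(g has_derivative g') (at (x + (0::real) *\<^sub>R axis i 1))"
    using assms by simp
  have 3: "((\<lambda>h::real. g (x + h *\<^sub>R axis i 1)) has_derivative (\<lambda>h. g' (h *\<^sub>R axis i 1))) (at 0)"
    using has_derivative_compose[OF 1 2] .
  have "(\<lambda>h. g' (h *\<^sub>R axis i 1)) = (*) (g' (axis i 1))"
    using linear_scale[OF has_derivative_linear[OF assms]] by (auto simp: mult.commute)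
  with 3 have "((\<lambda>h::real. g (x + h *\<^sub>R axis i 1)) has_field_derivative g' (axis i 1)) (at 0)"
    by (simp add: has_field_derivative_def)
  then show ?thesis
    unfolding partial_deriv_def by (rule DERIV_imp_deriv)
qed

lemma gradient_eq:
  assumes "GDERIV g x :> d"
  shows "gradient g x = d"
  using partial_deriv_eq[OF assms[unfolded gderiv_def]]
  by (simp add: gradient_def vec_eq_iff inner_axis' inner_axis)

end

theory Submission
  imports Defs
begin

text \<open>Put \<open>w = D\<^sup>T v\<close>. Since \<open>p \<nabla> log p = \<nabla> p\<close>, the two integrands, multiplied by the density,
  differ by \<open>div (p w)\<close>, and \<open>b\<close> cancels. So it suffices that an integrable \<open>C\<^sup>1\<close> field with
  integrable divergence has total divergence zero. For one compactly supported function, the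
  integral of a partial derivative is the limit of integrals of difference quotients, which vanish
  by translation invariance. In general, multiply the field by the cutoff
  \<open>(max 0 (1 - |x|\<^sup>2 / R\<^sup>2))\<^sup>2\<close>, whose gradient is at most \<open>4 / R\<close>, and let \<open>R\<close> tend to infinity.\<close>

section \<open>Gradient calculus for continuously differentiable functions\<close>

text \<open>For real-valued functions the derivative operator and the gradient determine each other
  continuously: the coordinates of \<open>gradient g x\<close> are the values of the operator on the
  axis vectors, and \<open>blinfun_inner_left\<close> rebuilds the operator. This opens access to
  the \<open>GDERIV\<close> rules.\<close>

lemma continuously_differentiable_iff_gradient:
  fixes g :: "real^'n \<Rightarrow> real"
  shows "continuously_differentiable g \<longleftrightarrow>
    (\<forall>x. GDERIV g x :> gradient g x) \<and> continuous_on UNIV (gradient g)"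
proof
  assume "continuously_differentiable g"
  then obtain g' :: "real^'n \<Rightarrow> (real^'n) \<Rightarrow>\<^sub>L real"
    where g': "\<And>x. (g has_derivative blinfun_apply (g' x)) (at x)" "continuous_on UNIV g'"
    unfolding continuously_differentiable_def by auto
  have pd: "partial_deriv i g x = g' x (axis i 1)" for i x
    using partial_deriv_eq[OF g'(1)] .
  have "blinfun_apply (g' x) = (\<lambda>h. h \<bullet> gradient g x)" for x
  proof
    fix h
    have "blinfun_apply (g' x) h = g' x (\<Sum>i\<in>UNIV. h $ i *s axis i 1)"
      by (simp only: basis_expansion)
    also have "\<dots> = (\<Sum>i\<in>UNIV. h $ i * g' x (axis i 1))"
      by (simp add: blinfun.sum_right blinfun.scaleR_right scalar_mult_eq_scaleR)
    finally show "blinfun_apply (g' x) h = h \<bullet> gradient g x"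
      by (simp add: inner_vec_def gradient_def pd)
  qed
  then have "GDERIV g x :> gradient g x" for x
    using g'(1)[of x] by (simp add: gderiv_def)
  moreover have "continuous_on UNIV (gradient g)"
    unfolding gradient_def pd
    by (intro continuous_intros g'(2))
  ultimately show "(\<forall>x. GDERIV g x :> gradient g x) \<and> continuous_on UNIV (gradient g)"
    by blast
next
  assume "(\<forall>x. GDERIV g x :> gradient g x) \<and> continuous_on UNIV (gradient g)"
  then show "continuously_differentiable g"
    unfolding continuously_differentiable_def gderiv_def
    by (intro exI[of _ "\<lambda>x. blinfun_inner_left (gradient g x)"])
       (auto intro!: continuous_intros bounded_linear.continuous_on[OF bounded_linear_blinfun_inner_left])
qed

lemma continuously_differentiableI_gderiv:
  fixes g :: "real^'n \<Rightarrow> real"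
  assumes "\<And>x. GDERIV g x :> d x" "continuous_on UNIV d"
  shows "continuously_differentiable g"
proof -
  have "gradient g = d"
    using gradient_eq[OF assms(1)] by auto
  with assms show ?thesis
    by (simp add: continuously_differentiable_iff_gradient)
qed

lemma continuously_differentiable_imp_gderiv:
  fixes g :: "real^'n \<Rightarrow> real"
  assumes "continuously_differentiable g"
  shows "GDERIV g x :> gradient g x"
  using assms by (simp add: continuously_differentiable_iff_gradient)

lemma continuously_differentiable_imp_continuous_on:
  assumes "continuously_differentiable f"
  shows "continuous_on S f"
  using assms unfolding continuously_differentiable_def
  by (meson continuous_at_imp_continuous_on has_derivative_continuous)

lemma continuously_differentiable_mult:
  fixes f g :: "real^'n \<Rightarrow> real"
  assumes "continuously_differentiable f" "continuously_differentiable g"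
  shows "continuously_differentiable (\<lambda>x. f x * g x)"
proof (rule continuously_differentiableI_gderiv)
  show "GDERIV (\<lambda>x. f x * g x) x :> f x *\<^sub>R gradient g x + g x *\<^sub>R gradient f x" for x
    using assms by (intro GDERIV_mult continuously_differentiable_imp_gderiv)
  show "continuous_on UNIV (\<lambda>x. f x *\<^sub>R gradient g x + g x *\<^sub>R gradient f x)"
    using assms continuously_differentiable_imp_continuous_on[of f UNIV]
      continuously_differentiable_imp_continuous_on[of g UNIV]
    by (auto simp: continuously_differentiable_iff_gradient intro!: continuous_intros)
qed

lemma continuously_differentiable_sum:
  fixes f :: "'i \<Rightarrow> real^'n \<Rightarrow> real"
  assumes "\<And>i. i \<in> A \<Longrightarrow> continuously_differentiable (f i)"
  shows "continuously_differentiable (\<lambda>x. \<Sum>i\<in>A. f i x)"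
proof (rule continuously_differentiableI_gderiv)
  show "GDERIV (\<lambda>x. \<Sum>i\<in>A. f i x) x :> (\<Sum>i\<in>A. gradient (f i) x)" for x
    using assms unfolding gderiv_def inner_sum_right
    by (intro has_derivative_sum) (auto simp flip: gderiv_def intro: continuously_differentiable_imp_gderiv)
  show "continuous_on UNIV (\<lambda>x. \<Sum>i\<in>A. gradient (f i) x)"
    using assms by (intro continuous_on_sum) (auto simp: continuously_differentiable_iff_gradient)
qed

text \<open>Taking a coordinate is bounded linear, so it can be composed with the derivative. The
  entries may themselves be vectors, so two applications reach the entries of a matrix
  field.\<close>

lemma continuously_differentiable_nth:
  assumes "continuously_differentiable f"
  shows "continuously_differentiable (\<lambda>x. f x $ i)"
proof -
  from assms obtain f' where f': "\<And>x. (f has_derivative blinfun_apply (f' x)) (at x)"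
      "continuous_on UNIV f'"
    unfolding continuously_differentiable_def by auto
  have "((\<lambda>x. f x $ i) has_derivative blinfun_apply (Blinfun (\<lambda>y. y $ i) o\<^sub>L f' x)) (at x)" for x
    using bounded_linear.has_derivative[OF bounded_linear_vec_nth f'(1), of i x]
    by (rule has_derivative_eq_rhs)
       (simp add: fun_eq_iff bounded_linear_Blinfun_apply[OF bounded_linear_vec_nth])
  moreover have "continuous_on UNIV (\<lambda>x. Blinfun (\<lambda>y. y $ i) o\<^sub>L f' x)"
    by (intro continuous_intros f'(2))
  ultimately show ?thesis
    unfolding continuously_differentiable_def
    by (intro exI[of _ "\<lambda>x. Blinfun (\<lambda>y. y $ i) o\<^sub>L f' x"]) simp
qed

lemma divergence_eq_sum_gradient: "divergence F x = (\<Sum>i\<in>UNIV. gradient (\<lambda>y. F y $ i) x $ i)"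
  by (simp add: divergence_def gradient_def)

text \<open>The product rule in each coordinate, summed. It serves twice: for a cutoff times a
  field, and for the density times the field \<open>w\<close>.\<close>

lemma divergence_scaleR:
  fixes F :: "real^'n \<Rightarrow> real^'n"
  assumes "continuously_differentiable g"
    and "\<And>i. continuously_differentiable (\<lambda>x. F x $ i)"
  shows "divergence (\<lambda>y. g y *\<^sub>R F y) x = gradient g x \<bullet> F x + g x * divergence F x"
proof -
  have "gradient (\<lambda>y. (g y *\<^sub>R F y) $ i) x = g x *\<^sub>R gradient (\<lambda>y. F y $ i) x + F x $ i *\<^sub>R gradient g x" for i
    using assms by (auto intro!: gradient_eq GDERIV_mult continuously_differentiable_imp_gderiv)
  then show ?thesis
    by (simp add: divergence_eq_sum_gradient inner_vec_def sum.distrib sum_distrib_left mult.commute)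
qed

section \<open>Vanishing integrals for compact support\<close>

text \<open>The difference quotients \<open>q n\<close> along \<open>e\<close> converge pointwise to
  \<open>e \<bullet> d x\<close> and have integral zero. One constant on a fixed ball dominates them
  all, so dominated convergence yields both integrability and the value 0.\<close>

lemma has_bochner_integral_directional_derivative_eq_0:
  fixes g :: "'a::euclidean_space \<Rightarrow> real" and d :: "'a \<Rightarrow> 'a"
  assumes deriv: "\<And>x. GDERIV g x :> d x" and cont: "continuous_on UNIV d"
    and supp: "\<And>x. norm x \<ge> R \<Longrightarrow> g x = 0"
  shows "has_bochner_integral lborel (\<lambda>x. e \<bullet> d x) 0"
proof -
  define q where "q n x = (g (x + (1 / real (Suc n)) *\<^sub>R e) - g x) * real (Suc n)" for n x
  \<comment> \<open>Every \<open>q n\<close> vanishes outside the ball of radius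
    \<open>R + norm e\<close>; the intermediate point of the mean value theorem can lie a further
    \<open>norm e\<close> out, hence the factor 2.\<close>
  define S where "S = cball (0::'a) (R + 2 * norm e)"
  have g_cont: "continuous_on UNIV g"
    using deriv unfolding gderiv_def
    by (meson continuous_at_imp_continuous_on has_derivative_continuous)
  have g_meas [measurable]: "g \<in> borel_measurable borel"
    using g_cont by (rule borel_measurable_continuous_onI)
  have d_meas [measurable]: "d \<in> borel_measurable borel"
    using cont by (rule borel_measurable_continuous_onI)
  have "bounded ((\<lambda>x. e \<bullet> d x) ` S)"
    unfolding S_def
    by (intro compact_imp_bounded compact_continuous_image continuous_intros
          continuous_on_subset[OF cont]) auto
  then obtain L where L: "L > 0" "\<And>x. x \<in> S \<Longrightarrow> \<bar>e \<bullet> d x\<bar> \<le> L"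
    unfolding bounded_pos by auto
  have line: "((\<lambda>s. g (x + s *\<^sub>R e)) has_real_derivative e \<bullet> d (x + s *\<^sub>R e)) (at s)" for x s
  proof -
    have "((\<lambda>s. g (x + s *\<^sub>R e)) has_derivative (\<lambda>h. (h *\<^sub>R e) \<bullet> d (x + s *\<^sub>R e))) (at s)"
      by (rule has_derivative_compose[OF _ deriv[unfolded gderiv_def]])
         (auto intro!: derivative_eq_intros)
    then show ?thesis
      by (simp add: has_field_derivative_def mult.commute[of _ "e \<bullet> _"])
  qed
  \<comment> \<open>Inside the smaller ball the quotient is a directional derivative at a point of
    \<open>S\<close>. Outside it, both \<open>x\<close> and its translate have norm at least
    \<open>R\<close>, because the step is at most 1, so both values of \<open>g\<close> are
    0.\<close>
  have q_bound: "norm (q n x) \<le> indicator (cball 0 (R + norm e)) x *\<^sub>R L" for n x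
  proof -
    define h where "h = 1 / real (Suc n)"
    have h: "0 < h" "h \<le> 1" "real (Suc n) = 1 / h"
      by (auto simp: h_def)
    have he: "norm (s *\<^sub>R e) \<le> norm e" if "0 \<le> s" "s \<le> h" for s
      using that h by (simp add: mult_left_le_one_le)
    show ?thesis
    proof (cases "norm x \<le> R + norm e")
      case True
      obtain s where s: "0 < s" "s < h" "g (x + h *\<^sub>R e) - g (x + 0 *\<^sub>R e) = (h - 0) * (e \<bullet> d (x + s *\<^sub>R e))"
        using MVT2[of 0 h "\<lambda>s. g (x + s *\<^sub>R e)" "\<lambda>s. e \<bullet> d (x + s *\<^sub>R e)"] h line by blast
      have "norm (x + s *\<^sub>R e) \<le> R + 2 * norm e"
        using norm_triangle_ineq[of x "s *\<^sub>R e"] he[of s] s True by simp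
      then have "\<bar>e \<bullet> d (x + s *\<^sub>R e)\<bar> \<le> L"
        by (intro L) (simp add: S_def)
      moreover have "q n x = e \<bullet> d (x + s *\<^sub>R e)"
        using s h unfolding q_def h_def[symmetric] by simp
      ultimately show ?thesis
        using True by simp
    next
      case False
      then have "norm (x + h *\<^sub>R e) \<ge> R" "norm x \<ge> R"
        using norm_triangle_ineq2[of x "- (h *\<^sub>R e)"] he[of h] h
          norm_ge_zero[of e] by (simp_all del: norm_ge_zero)
      then show ?thesis
        using L(1) unfolding q_def h_def[symmetric] by (simp add: supp)
    qed
  qed
  have q_lim: "(\<lambda>n. q n x) \<longlonglongrightarrow> e \<bullet> d x" for x
  proof -
    have "(\<lambda>h. (g (x + h *\<^sub>R e) - g x) / h) \<midarrow>0\<rightarrow> e \<bullet> d x"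
      using line[of x 0] by (simp add: DERIV_def)
    moreover have "filterlim (\<lambda>n. 1 / real (Suc n)) (at 0) sequentially"
      by (auto simp: filterlim_at simp del: of_nat_Suc intro!: LIMSEQ_Suc[OF lim_1_over_n])
    ultimately have "(\<lambda>n. (g (x + (1 / real (Suc n)) *\<^sub>R e) - g x) / (1 / real (Suc n))) \<longlonglongrightarrow> e \<bullet> d x"
      by (rule filterlim_compose)
    then show ?thesis
      by (simp add: q_def)
  qed
  have g_int: "integrable lborel g"
  proof -
    have "integrable lborel (\<lambda>x. indicator (cball 0 R) x *\<^sub>R g x)"
      by (intro borel_integrable_compact continuous_on_subset[OF g_cont]) auto
    moreover have "(\<lambda>x. indicator (cball 0 R) x *\<^sub>R g x) = g"
      using supp by (fastforce simp: indicator_def)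
    ultimately show ?thesis
      by (simp only:)
  qed
  have q_integral: "(\<integral>x. q n x \<partial>lborel) = 0" for n
  proof -
    \<comment> \<open>Lebesgue measure is invariant under translation by \<open>?c\<close>; the
      translate is written \<open>?c + x\<close> to match the map \<open>(+) ?c\<close>.\<close>
    let ?c = "(1 / real (Suc n)) *\<^sub>R e"
    have int: "integrable lborel (\<lambda>x. g (?c + x))"
      using g_int integrable_distr_eq[of "(+) ?c" lborel borel g]
      by (simp add: lborel_distr_plus)
    have "(\<integral>x. g (?c + x) \<partial>lborel) = (\<integral>x. g x \<partial>lborel)"
      using integral_distr[of "(+) ?c" lborel borel g]
      by (simp add: lborel_distr_plus)
    moreover have "q n = (\<lambda>x. (g (?c + x) - g x) * real (Suc n))"
      by (simp add: q_def fun_eq_iff add.commute)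
    ultimately show ?thesis
      using int g_int by simp
  qed
  have dom: "integrable lborel (\<lambda>x. indicator (cball (0::'a) (R + norm e)) x *\<^sub>R L)"
    by (intro borel_integrable_compact) auto
  have meas: "(\<lambda>x. e \<bullet> d x) \<in> borel_measurable lborel" "\<And>n. q n \<in> borel_measurable lborel"
    unfolding q_def by measurable
  note dct = meas dom AE_I2[OF q_lim] AE_I2[OF q_bound]
  have "(\<lambda>n. \<integral>x. q n x \<partial>lborel) \<longlonglongrightarrow> (\<integral>x. e \<bullet> d x \<partial>lborel)"
    by (rule integral_dominated_convergence[OF dct])
  then have "(\<integral>x. e \<bullet> d x \<partial>lborel) = 0"
    by (simp add: q_integral LIMSEQ_const_iff)
  moreover have "integrable lborel (\<lambda>x. e \<bullet> d x)"
    by (rule integrable_dominated_convergence[OF dct])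
  ultimately show ?thesis
    by (simp add: has_bochner_integral_iff)
qed

lemma integral_divergence_eq_0_compact_support:
  fixes F :: "real^'n \<Rightarrow> real^'n"
  assumes C1: "\<And>i. continuously_differentiable (\<lambda>x. F x $ i)"
    and supp: "\<And>x. norm x \<ge> R \<Longrightarrow> F x = 0"
  shows "(\<integral>x. divergence F x \<partial>lborel) = 0"
proof -
  have "has_bochner_integral lborel (\<lambda>x. axis i 1 \<bullet> gradient (\<lambda>y. F y $ i) x) 0" for i
    using C1[of i] supp
    by (intro has_bochner_integral_directional_derivative_eq_0[where g = "\<lambda>y. F y $ i" and R = R])
       (auto simp: continuously_differentiable_iff_gradient)
  then have "has_bochner_integral lborel (\<lambda>x. \<Sum>i\<in>UNIV. axis i 1 \<bullet> gradient (\<lambda>y. F y $ i) x)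
      (\<Sum>i\<in>(UNIV::'n set). 0)"
    by (intro has_bochner_integral_sum)
  then show ?thesis
    by (simp add: divergence_eq_sum_gradient inner_axis' has_bochner_integral_iff)
qed

section \<open>A continuously differentiable cutoff\<close>

text \<open>Squaring removes the kink of the positive part: at the origin the difference quotient is
  at most \<open>\<bar>h\<bar>\<close> in size, and elsewhere the function is locally 0 or
  \<open>u\<^sup>2\<close>.\<close>

lemma has_real_derivative_max_0_power2:
  "((\<lambda>u. (max 0 u)\<^sup>2) has_real_derivative 2 * max 0 u) (at (u::real))"
proof -
  consider "u < 0" | "u = 0" | "u > 0" by linarith
  then show ?thesis
  proof cases
    case 1
    have "((\<lambda>u. 0) has_real_derivative 2 * max 0 u) (at u)"
      using 1 by simp
    then show ?thesis
      by (rule has_field_derivative_transform_within_open[of _ _ _ "{..<0}"]) (use 1 in auto)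
  next
    case 2
    have "(\<lambda>h::real. (max 0 h)\<^sup>2 / h) \<midarrow>0\<rightarrow> 0"
    proof (rule Lim_null_comparison)
      show "\<forall>\<^sub>F h::real in at 0. norm ((max 0 h)\<^sup>2 / h) \<le> \<bar>h\<bar>"
        by (auto simp: max_def power2_eq_square)
    qed (auto intro!: tendsto_eq_intros)
    then show ?thesis
      using 2 by (simp add: DERIV_def)
  next
    case 3
    have "((\<lambda>u. u\<^sup>2) has_real_derivative 2 * max 0 u) (at u)"
      using 3 by (auto intro!: derivative_eq_intros)
    then show ?thesis
      by (rule has_field_derivative_transform_within_open[of _ _ _ "{0<..}"]) (use 3 in auto)
  qed
qed

text \<open>The outer square makes the positive part continuously differentiable across the sphere
  of radius \<open>R\<close>, and \<open>x \<bullet> x\<close> in place of the norm avoids a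
  singularity at the origin.\<close>

definition cutoff :: "real \<Rightarrow> real^'n \<Rightarrow> real" where
  "cutoff R x = (max 0 (1 - (x \<bullet> x) / R\<^sup>2))\<^sup>2"

text \<open>The chain rule through the squared positive part. For \<open>R = 0\<close>, division by
  zero gives 0, so the cutoff is constantly 1 and the formula gives gradient 0.\<close>

lemma cutoff_gderiv:
  "GDERIV (cutoff R) x :> (- 4 * max 0 (1 - (x \<bullet> x) / R\<^sup>2) / R\<^sup>2) *\<^sub>R x"
proof -
  have "((\<lambda>x. 1 - (x \<bullet> x) / R\<^sup>2) has_derivative (\<lambda>h. - 2 * (h \<bullet> x) / R\<^sup>2)) (at x)"
    unfolding divide_inverse
    by (auto intro!: derivative_eq_intros simp: fun_eq_iff inner_commute)
  from has_derivative_compose[OF this has_real_derivative_max_0_power2[unfolded has_field_derivative_def]]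
  show ?thesis
    unfolding gderiv_def cutoff_def by (rule has_derivative_eq_rhs) (simp add: fun_eq_iff)
qed

lemma gradient_cutoff: "gradient (cutoff R) x = (- 4 * max 0 (1 - (x \<bullet> x) / R\<^sup>2) / R\<^sup>2) *\<^sub>R x"
  by (rule gradient_eq[OF cutoff_gderiv])

lemma continuously_differentiable_cutoff: "continuously_differentiable (cutoff R)"
  by (rule continuously_differentiableI_gderiv[OF cutoff_gderiv])
     (unfold divide_inverse, intro continuous_intros continuous_on_max)

lemma abs_cutoff_le_1: "\<bar>cutoff R x\<bar> \<le> 1"
  unfolding cutoff_def by (auto intro!: power_le_one)

lemma cutoff_eq_0: "norm x \<ge> R \<Longrightarrow> R > 0 \<Longrightarrow> cutoff R x = 0"
  by (simp add: cutoff_def max_def dot_square_norm field_simps)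

text \<open>In the ball the factor with \<open>max\<close> is at most 1 and
  \<open>norm x / R\<^sup>2\<close> is at most \<open>1 / R\<close>; outside the ball the factor
  with \<open>max\<close> is 0.\<close>

lemma norm_gradient_cutoff_le:
  assumes "R > 0"
  shows "norm (gradient (cutoff R) x) \<le> 4 / R"
proof (cases "norm x \<le> R")
  case True
  have "norm (gradient (cutoff R) x) = 4 * max 0 (1 - (x \<bullet> x) / R\<^sup>2) * (norm x / R\<^sup>2)"
    by (simp add: gradient_cutoff abs_mult)
  also have "\<dots> \<le> 4 * 1 * (R / R\<^sup>2)"
    using True assms by (intro mult_mono divide_right_mono) auto
  finally show ?thesis
    using assms by (simp add: power2_eq_square)
next
  case False
  then have "(x \<bullet> x) / R\<^sup>2 \<ge> 1"
    using assms by (simp add: dot_square_norm)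
  then show ?thesis
    using assms by (simp add: gradient_cutoff max_def)
qed

lemma cutoff_tendsto_1: "(\<lambda>n. cutoff (real (Suc n)) x) \<longlonglongrightarrow> 1"
proof -
  have "(\<lambda>n. 1 / real (Suc n)) \<longlonglongrightarrow> 0"
    by (rule LIMSEQ_Suc[OF lim_1_over_n])
  \<comment> \<open>With \<open>(1 / real (Suc n))\<^sup>2\<close> in place of division by a square,
    the limit follows by continuity.\<close>
  then have "(\<lambda>n. (max 0 (1 - (x \<bullet> x) * (1 / real (Suc n))\<^sup>2))\<^sup>2) \<longlonglongrightarrow> (max 0 (1 - (x \<bullet> x) * 0\<^sup>2))\<^sup>2"
    by (intro tendsto_intros)
  then show ?thesis
    by (simp add: cutoff_def power_divide)
qed

section \<open>Integrable fields on the whole space\<close>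

text \<open>The product rule splits the divergence of the truncated field into a part tending to
  \<open>divergence F x\<close> and a part bounded by \<open>4 / R * norm (F x)\<close>, which tends
  to 0. Integrability of \<open>F\<close> and of its divergence supplies the dominating
  function.\<close>

theorem integral_divergence_eq_0:
  fixes F :: "real^'n \<Rightarrow> real^'n"
  assumes C1: "\<And>i. continuously_differentiable (\<lambda>x. F x $ i)"
    and F_int: "integrable lborel F"
    and div_int: "integrable lborel (divergence F)"
  shows "(\<integral>x. divergence F x \<partial>lborel) = 0"
proof -
  \<comment> \<open>\<open>Suc n\<close> keeps the radius positive, as the support and gradient
    bounds of the cutoff require, and at least 1, so that \<open>4 / real (Suc n)\<close> is at most
    4 in the domination.\<close>
  define G where "G n = divergence (\<lambda>y. cutoff (real (Suc n)) y *\<^sub>R F y)" for n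
  have G_eq: "G n x = gradient (cutoff (real (Suc n))) x \<bullet> F x + cutoff (real (Suc n)) x * divergence F x" for n x
    unfolding G_def by (intro divergence_scaleR continuously_differentiable_cutoff C1)
  have G_integral: "(\<integral>x. G n x \<partial>lborel) = 0" for n
    unfolding G_def
    by (rule integral_divergence_eq_0_compact_support[where R = "real (Suc n)"])
       (auto intro!: continuously_differentiable_mult continuously_differentiable_cutoff C1 cutoff_eq_0
          simp del: of_nat_Suc)
  have grad_bound: "\<bar>gradient (cutoff (real (Suc n))) x \<bullet> F x\<bar> \<le> 4 / real (Suc n) * norm (F x)" for n x
    by (rule order_trans[OF Cauchy_Schwarz_ineq2 mult_right_mono[OF norm_gradient_cutoff_le]]) auto
  have G_bound: "norm (G n x) \<le> 4 * norm (F x) + \<bar>divergence F x\<bar>" for n x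
  proof -
    have "4 / real (Suc n) * norm (F x) \<le> 4 * norm (F x)"
      by (intro mult_right_mono) (auto simp: field_simps)
    moreover have "\<bar>cutoff (real (Suc n)) x * divergence F x\<bar> \<le> \<bar>divergence F x\<bar>"
      by (simp add: abs_mult mult_left_le_one_le abs_cutoff_le_1 del: of_nat_Suc)
    ultimately show ?thesis
      using grad_bound[of n x] unfolding G_eq by simp
  qed
  have G_lim: "(\<lambda>n. G n x) \<longlonglongrightarrow> divergence F x" for x
  proof -
    have "(\<lambda>n. 4 * (1 / real (Suc n)) * norm (F x)) \<longlonglongrightarrow> 4 * 0 * norm (F x)"
      by (intro tendsto_intros LIMSEQ_Suc[OF lim_1_over_n])
    then have bound_lim: "(\<lambda>n. 4 / real (Suc n) * norm (F x)) \<longlonglongrightarrow> 0"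
      by simp
    have "(\<lambda>n. gradient (cutoff (real (Suc n))) x \<bullet> F x) \<longlonglongrightarrow> 0"
      by (rule Lim_null_comparison[OF always_eventually bound_lim])
         (simp only: real_norm_def grad_bound, simp)
    then have "(\<lambda>n. G n x) \<longlonglongrightarrow> 0 + 1 * divergence F x"
      unfolding G_eq by (intro tendsto_intros cutoff_tendsto_1)
    then show ?thesis by simp
  qed
  have [measurable]: "F \<in> borel_measurable borel" "divergence F \<in> borel_measurable borel"
    using F_int div_int by (auto dest!: borel_measurable_integrable)
  have [measurable]: "(cutoff R :: real^'n \<Rightarrow> real) \<in> borel_measurable borel"
    "gradient (cutoff R :: real^'n \<Rightarrow> real) \<in> borel_measurable borel" for R
    using continuously_differentiable_cutoff[of R]
      continuously_differentiable_imp_continuous_on[OF continuously_differentiable_cutoff[of R]]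
    by (auto intro!: borel_measurable_continuous_onI simp: continuously_differentiable_iff_gradient)
  have G_meas: "G n \<in> borel_measurable lborel" for n
    unfolding G_eq[abs_def] by measurable
  have "(\<lambda>n. \<integral>x. G n x \<partial>lborel) \<longlonglongrightarrow> (\<integral>x. divergence F x \<partial>lborel)"
    using F_int div_int
    by (intro integral_dominated_convergence[OF _ G_meas _ AE_I2[OF G_lim] AE_I2[OF G_bound]]) auto
  then show ?thesis
    by (simp add: G_integral LIMSEQ_const_iff)
qed

section \<open>Integration by parts against the density\<close>

text \<open>Entries are bounded by norms, and the Euclidean norm by the sum of absolute coordinates.
  The constant is crude; it only has to turn bounds on the matrix field and the velocity into a
  bound on their product.\<close>

lemma norm_matrix_vector_mult_transpose_le:
  fixes A :: "real^'n^'m"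
  shows "norm (transpose A *v x) \<le> real CARD('n) * real CARD('m) * (norm A * norm x)"
proof -
  have "\<bar>(transpose A *v x) $ j\<bar> \<le> real CARD('m) * (norm A * norm x)" for j
  proof -
    have "\<bar>(transpose A *v x) $ j\<bar> \<le> (\<Sum>i\<in>UNIV. \<bar>A $ i $ j * x $ i\<bar>)"
      unfolding matrix_vector_mult_def transpose_def by simp
    also have "\<dots> \<le> (\<Sum>i\<in>(UNIV::'m set). norm A * norm x)"
    proof (intro sum_mono)
      fix i
      have "\<bar>A $ i $ j\<bar> \<le> norm A"
        using component_le_norm_cart[of "A $ i" j] Finite_Cartesian_Product.norm_nth_le[of A i] by simp
      then show "\<bar>A $ i $ j * x $ i\<bar> \<le> norm A * norm x"
        unfolding abs_mult by (intro mult_mono component_le_norm_cart) auto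
    qed
    finally show ?thesis by simp
  qed
  then have "(\<Sum>j\<in>UNIV. \<bar>(transpose A *v x) $ j\<bar>) \<le> (\<Sum>j\<in>(UNIV::'n set). real CARD('m) * (norm A * norm x))"
    by (intro sum_mono)
  then show ?thesis
    using norm_le_l1_cart[of "transpose A *v x"] by simp
qed

text \<open>Existence of both expectations is assumed explicitly: \<open>b\<close> is arbitrary, and
  the integral of a non-integrable function is 0 by convention.\<close>

theorem proposition3p1:
  fixes T t :: real
    and \<theta> \<theta>' :: 'w
    and b :: "real \<Rightarrow> real^'n \<Rightarrow> real^'n"
    and D :: "real \<Rightarrow> real^'n \<Rightarrow> real^'n^'n"
    and v :: "'w \<Rightarrow> real \<Rightarrow> real^'n \<Rightarrow> real^'n"
    and \<mu> :: "'w \<Rightarrow> real \<Rightarrow> (real^'n) measure"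
    and p :: "'w \<Rightarrow> real \<Rightarrow> real^'n \<Rightarrow> real"
  assumes "T > 0" and "t \<in> {0..T}"
    and D_psd: "\<And>x. positive_semidefinite (D t x)"
    and D_bounded: "bounded (range (D t))"
    and D_C1: "continuously_differentiable (D t)"
    and v_bounded: "bounded (range (v \<theta> t))"
    and v_C1: "continuously_differentiable (v \<theta> t)"
    and mu_prob: "prob_space (\<mu> \<theta>' t)"
    and mu_density: "\<mu> \<theta>' t = density lborel (\<lambda>x. ennreal (p \<theta>' t x))"
    and p_nonneg: "\<And>x. 0 \<le> p \<theta>' t x"
    and p_C1: "continuously_differentiable (p \<theta>' t)"
    and p_vanishes_at_infinity: "(p \<theta>' t \<longlongrightarrow> 0) at_infinity"
    and p_nonzero: "\<And>x. p \<theta>' t x \<noteq> 0"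
    and lhs_expectation_exists:
      "integrable (\<mu> \<theta>' t) (\<lambda>x. v \<theta> t x \<bullet> fokker_planck_velocity (b t) (D t) (p \<theta>' t) x)"
    and rhs_expectation_exists:
      "integrable (\<mu> \<theta>' t) (\<lambda>x. v \<theta> t x \<bullet> b t x
         + divergence (\<lambda>y. transpose (D t y) *v v \<theta> t y) x)"
  shows "(\<integral>x. v \<theta> t x \<bullet> fokker_planck_velocity (b t) (D t) (p \<theta>' t) x \<partial>\<mu> \<theta>' t)
       = (\<integral>x. v \<theta> t x \<bullet> b t x + divergence (\<lambda>y. transpose (D t y) *v v \<theta> t y) x \<partial>\<mu> \<theta>' t)"
proof -
  define q where "q = p \<theta>' t"
  define w where "w = (\<lambda>y. transpose (D t y) *v v \<theta> t y)"
  define f where "f = (\<lambda>x. v \<theta> t x \<bullet> fokker_planck_velocity (b t) (D t) q x)"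
  define g where "g = (\<lambda>x. v \<theta> t x \<bullet> b t x + divergence w x)"
  \<comment> \<open>Positivity makes \<open>ln (q x)\<close> differentiable and lets
    \<open>q x\<close> cancel the inverse in its gradient.\<close>
  have q_pos: "q x > 0" for x
    using p_nonneg[of x] p_nonzero[of x] unfolding q_def by linarith
  have q_C1: "continuously_differentiable q"
    using p_C1 by (simp add: q_def)
  have mu: "\<mu> \<theta>' t = density lborel (\<lambda>x. ennreal (q x))"
    using mu_density by (simp add: q_def)
  have q_meas [measurable]: "q \<in> borel_measurable borel"
    by (intro borel_measurable_continuous_onI continuously_differentiable_imp_continuous_on q_C1)

  have w_C1: "continuously_differentiable (\<lambda>x. w x $ j)" for j
    unfolding w_def matrix_vector_mult_def transpose_def
    by (simp, intro continuously_differentiable_sum continuously_differentiable_mult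
        continuously_differentiable_nth D_C1 v_C1)
  \<comment> \<open>A uniform bound on \<open>w\<close> makes \<open>q x *\<^sub>R w x\<close>
    integrable, dominated by \<open>K\<close> times the density.\<close>
  obtain K where K: "\<And>x. norm (w x) \<le> K"
  proof -
    obtain B C where "\<And>x. norm (D t x) \<le> B" "\<And>x. norm (v \<theta> t x) \<le> C"
      using D_bounded v_bounded unfolding bounded_iff by auto
    then have "norm (w x) \<le> real CARD('n) * real CARD('n) * (B * C)" for x
      unfolding w_def
      by (intro order_trans[OF norm_matrix_vector_mult_transpose_le] mult_left_mono mult_mono)
         (auto intro: order_trans[OF norm_ge_zero])
    then show ?thesis by (rule that)
  qed

  have grad_ln: "gradient (\<lambda>y. ln (q y)) x = inverse (q x) *\<^sub>R gradient q x" for x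
    using GDERIV_DERIV_compose[OF continuously_differentiable_imp_gderiv[OF q_C1] DERIV_ln] q_pos[of x]
    by (intro gradient_eq) simp
  \<comment> \<open>The transpose moves the matrix from the gradient onto the velocity,
    \<open>q\<close> times the logarithmic gradient is \<open>gradient q x\<close>, and the terms
    with \<open>b\<close> cancel. What remains is the product rule.\<close>
  have diff: "q x * g x - q x * f x = divergence (\<lambda>y. q y *\<^sub>R w y) x" for x
  proof -
    have "v \<theta> t x \<bullet> (D t x *v gradient q x) = gradient q x \<bullet> w x"
      by (simp add: w_def transpose_matrix_vector dot_lmul_matrix inner_commute[of "gradient q x"])
    then show ?thesis
      using q_pos[of x]
      by (simp add: f_def g_def fokker_planck_velocity_def grad_ln divergence_scaleR[OF q_C1 w_C1]
          inner_diff_right matrix_vector_mult_scaleR field_simps)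
  qed

  have f_int: "integrable (\<mu> \<theta>' t) f" and g_int: "integrable (\<mu> \<theta>' t) g"
    using lhs_expectation_exists rhs_expectation_exists by (simp_all add: f_def g_def q_def w_def)
  \<comment> \<open>Both functions involve the arbitrary \<open>b\<close>, so their measurability is
    drawn from their integrability; passing to a density leaves the sigma-algebra unchanged.\<close>
  have meas [measurable]: "f \<in> borel_measurable borel" "g \<in> borel_measurable borel"
    using borel_measurable_integrable[OF f_int] borel_measurable_integrable[OF g_int]
    by (simp_all add: mu)
  have qf_int: "integrable lborel (\<lambda>x. q x * f x)" and qg_int: "integrable lborel (\<lambda>x. q x * g x)"
    using f_int g_int q_pos by (simp_all add: mu integrable_density less_imp_le)

  \<comment> \<open>The integral of \<open>q\<close> is the total mass 1, so \<open>q\<close> is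
    integrable.\<close>
  have "emeasure (\<mu> \<theta>' t) (space (\<mu> \<theta>' t)) = 1"
    using mu_prob by (rule prob_space.emeasure_space_1)
  then have "(\<integral>\<^sup>+x. ennreal (q x) \<partial>lborel) = 1"
    by (simp add: mu emeasure_density)
  then have q_int: "integrable lborel q"
    using q_pos by (intro integrableI_nonneg) (auto simp: less_imp_le)
  have "continuous_on UNIV w"
    by (intro continuous_on_vec_lambda[of UNIV "\<lambda>j x. w x $ j", simplified]
          continuously_differentiable_imp_continuous_on w_C1)
  then have [measurable]: "w \<in> borel_measurable borel"
    by (rule borel_measurable_continuous_onI)
  have "integrable lborel (\<lambda>x. q x *\<^sub>R w x)"
  proof (rule Bochner_Integration.integrable_bound)
    show "integrable lborel (\<lambda>x. q x * K)"
      using q_int by simp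
    show "AE x in lborel. norm (q x *\<^sub>R w x) \<le> norm (q x * K)"
      using q_pos K by (intro AE_I2) (auto simp: abs_mult intro!: mult_left_mono order_trans[OF K])
  qed measurable
  \<comment> \<open>No estimate of derivatives enters: by \<open>diff\<close> this divergence is the
    difference of two functions that are integrable because the expectations exist.\<close>
  moreover have "integrable lborel (divergence (\<lambda>y. q y *\<^sub>R w y))"
    using Bochner_Integration.integrable_diff[OF qg_int qf_int] by (simp add: diff)
  moreover have "continuously_differentiable (\<lambda>x. (q x *\<^sub>R w x) $ i)" for i
    by (simp add: continuously_differentiable_mult q_C1 w_C1)
  ultimately have "(\<integral>x. divergence (\<lambda>y. q y *\<^sub>R w y) x \<partial>lborel) = 0"
    by (intro integral_divergence_eq_0)
  then have "(\<integral>x. q x * g x \<partial>lborel) - (\<integral>x. q x * f x \<partial>lborel) = 0"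
    using Bochner_Integration.integral_diff[OF qg_int qf_int] by (simp add: diff)
  then have "(\<integral>x. f x \<partial>\<mu> \<theta>' t) = (\<integral>x. g x \<partial>\<mu> \<theta>' t)"
    using q_pos by (simp add: mu integral_density less_imp_le)
  then show ?thesis
    by (simp only: f_def g_def q_def w_def)
qed

end
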